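(* Let $\mathbb{K}$ be a field, let $n\ge 1$, and let $S=\mathbb{K}[x_1,\dots,x_n]$. Let $d\ge 0$ be an integer and let $I\subset S$ be a nonzero ideal generated by squarefree monomials of degree $\ge d$. Let $\mu_d(I)$ denote the number of monomials of degree $d$ in the minimal monomial generating set of $I$. If $$\mu_d(I)\le \min\left(\binom{n}{d+1},\ \sum_{j=1}^{n-d}\binom{2j-1}{j}\right),$$ then the Stanley depth of $I$ satisfies $\operatorname{sdepth}_S(I)\ge d+1$.
   Context: The ring $S=\mathbb{K}[x_1,\dots,x_n]$ carries its natural $\mathbb{Z}^n$-grading, and monomial ideals are $\mathbb{Z}^n$-graded $S$-modules. For a nonzero finitely generated $\mathbb{Z}^n$-graded $S$-module $M$, a Stanley decomposition of $M$ is a finite direct sum decomposition $\mathcal{P}: M=\bigoplus_{i=1}^m u_i\mathbb{K}[Z_i]$ of $M$ as a $\mathbb{Z}^n$-graded $\mathbb{K}$-vector space, where each $u_i\in M$ is homogeneous, $Z_i\subset\{x_1,\dots,x_n\}$, and $u_i\mathbb{K}[Z_i]$ is a free $\mathbb{K}[Z_i]$-submodule of $M$. Its Stanley depth is $\operatorname{sdepth}(\mathcal{P})=\min\{|Z_i|:1\le i\le m\}$, and $\operatorname{sdepth}_S(M)=\operatorname{sdepth}(M)$ is the maximum of $\operatorname{sdepth}(\mathcal{P})$ over all Stanley decompositions $\mathcal{P}$ of $M$. An empty sum equals $0$. *)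

theory Defs
  imports Complex_Main "HOL-Library.Cardinality" "HOL-Library.Poly_Mapping"
begin

text \<open>
  The polynomial ring in the variables indexed by a finite type \<open>'n\<close> over \<open>'k\<close>:
  finitely supported functions from exponent vectors to coefficients, with the convolution
  product of \<open>Poly_Mapping\<close>.
\<close>

type_synonym 'n expo = "'n \<Rightarrow>\<^sub>0 nat"
type_synonym ('n, 'k) mpoly = "('n \<Rightarrow>\<^sub>0 nat) \<Rightarrow>\<^sub>0 'k"

definition monomial :: "'n expo \<Rightarrow> ('n, 'k::field) mpoly" where
  "monomial a = Poly_Mapping.single a 1"

definition total_degree :: "('n::finite) expo \<Rightarrow> nat" where
  "total_degree a = (\<Sum>i\<in>UNIV. Poly_Mapping.lookup a i)"

definition squarefree_expo :: "'n expo \<Rightarrow> bool" where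
  "squarefree_expo a \<longleftrightarrow> (\<forall>i. Poly_Mapping.lookup a i \<le> 1)"

text \<open>A commutative ring as a module over itself: its submodules are its ideals, and
  \<open>ideal.span B\<close> is the ideal generated by \<open>B\<close>.\<close>

interpretation ideal: module "(*) :: 'a::comm_ring_1 \<Rightarrow> 'a \<Rightarrow> 'a"
  by unfold_locales (simp_all add: algebra_simps)

text \<open>The description operator is justified for all monomial ideals by the lemma
  \<open>ex1_minimal_monomial_generators\<close> below.\<close>

definition is_minimal_monomial_generators ::
    "('n, 'k::field) mpoly set \<Rightarrow> ('n, 'k) mpoly set \<Rightarrow> bool" where
  "is_minimal_monomial_generators I G \<longleftrightarrow>
     G \<subseteq> range monomial \<and> ideal.span G = I \<and> (\<forall>H. H \<subset> G \<longrightarrow> ideal.span H \<noteq> I)"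

definition minimal_monomial_generators ::
    "('n, 'k::field) mpoly set \<Rightarrow> ('n, 'k) mpoly set" where
  "minimal_monomial_generators I = (THE G. is_minimal_monomial_generators I G)"

definition mu :: "nat \<Rightarrow> ('n::finite, 'k::field) mpoly set \<Rightarrow> nat" where
  "mu d I = card {g \<in> minimal_monomial_generators I. \<exists>a. g = monomial a \<and> total_degree a = d}"

definition subring_vars :: "'n set \<Rightarrow> ('n, 'k::field) mpoly set" where
  "subring_vars Z = {p. \<forall>m\<in>Poly_Mapping.keys p. Poly_Mapping.keys m \<subseteq> Z}"

text \<open>Nonzero finitely generated modules graded by the integer vectors: \<open>M\<close> is the carrier
  inside an ambient type, and \<open>comp a\<close> is the homogeneous component of degree \<open>a\<close>. Taking
  \<open>b = 0\<close> in \<open>scale_comp\<close> shows that the components are subspaces over the base field.\<close>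

locale multigraded_module = module scale
  for scale :: "('n::finite, 'k::field) mpoly \<Rightarrow> 'm::ab_group_add \<Rightarrow> 'm" +
  fixes M :: "'m set" and comp :: "('n \<Rightarrow> int) \<Rightarrow> 'm set"
  assumes submodule: "subspace M"
    and nonzero: "M \<noteq> {0}"
    and finitely_generated: "\<exists>F. finite F \<and> span F = M"
    and comp_subset: "comp a \<subseteq> M"
    and comp_zero: "0 \<in> comp a"
    and comp_add: "u \<in> comp a \<Longrightarrow> v \<in> comp a \<Longrightarrow> u + v \<in> comp a"
    and scale_comp: "u \<in> comp a \<Longrightarrow>
      scale (Poly_Mapping.single b c) u \<in> comp (\<lambda>i. a i + int (Poly_Mapping.lookup b i))"
    and decomposition: "x \<in> M \<Longrightarrow>
      \<exists>!f. finite {a. f a \<noteq> 0} \<and> (\<forall>a. f a \<in> comp a) \<and> x = (\<Sum>a | f a \<noteq> 0. f a)"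
begin

definition stanley_space :: "'m \<Rightarrow> 'n set \<Rightarrow> 'm set" where
  "stanley_space u Z = (\<lambda>p. scale p u) ` subring_vars Z"

text \<open>A decomposition is the list of its pairs \<open>(u, Z)\<close>. The condition that \<open>p u = 0\<close>
  implies \<open>p = 0\<close> says that the cyclic module is free with basis \<open>u\<close>. Each summand lies in
  \<open>M\<close>, and is a graded subspace because \<open>u\<close> is homogeneous; so it remains to require that
  every element of \<open>M\<close> is a sum of elements of the summands in exactly one way.\<close>

definition stanley_decomposition :: "('m \<times> 'n set) list \<Rightarrow> bool" where
  "stanley_decomposition P \<longleftrightarrow>
     (\<forall>(u, Z) \<in> set P. u \<in> M \<and> (\<exists>a. u \<in> comp a) \<and>
        (\<forall>p \<in> subring_vars Z. scale p u = 0 \<longrightarrow> p = 0)) \<and>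
     (\<forall>x\<in>M. \<exists>!vs. length vs = length P \<and>
        (\<forall>i<length P. vs ! i \<in> stanley_space (fst (P ! i)) (snd (P ! i))) \<and>
        sum_list vs = x)"

definition sdepth_decomposition :: "('m \<times> 'n set) list \<Rightarrow> nat" where
  "sdepth_decomposition P = Min ((\<lambda>(u, Z). card Z) ` set P)"

definition sdepth :: nat where
  "sdepth = Max {sdepth_decomposition P | P. stanley_decomposition P}"

end

definition poly_comp :: "('n \<Rightarrow> int) \<Rightarrow> ('n, 'k::field) mpoly set" where
  "poly_comp a = {p. \<forall>m\<in>Poly_Mapping.keys p. \<forall>i. int (Poly_Mapping.lookup m i) = a i}"

text \<open>Stanley depth of an ideal with the grading inherited from the polynomial ring;
  \<open>multigraded_module_ideal\<close> below shows that finitely generated monomial ideals are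
  multigraded modules.\<close>

definition sdepth_ideal :: "('n::finite, 'k::field) mpoly set \<Rightarrow> nat" where
  "sdepth_ideal I = multigraded_module.sdepth (*) I (\<lambda>a. I \<inter> poly_comp a)"

lemma keys_in_monomial_ideal:
  assumes "(p :: ('n, 'k::field) mpoly) \<in> ideal.span (monomial ` A)" "m \<in> Poly_Mapping.keys p"
  shows "\<exists>a\<in>A. \<exists>c. m = c + a"
  using assms
proof (induction arbitrary: m rule: ideal.span_induct_alt)
  case base
  then show ?case by simp
next
  case (step c x y)
  then obtain a where a: "a \<in> A" "x = monomial a" by auto
  show ?case
  proof (cases "m \<in> Poly_Mapping.keys y")
    case False
    then have "m \<in> Poly_Mapping.keys (c * x)"
      using step.prems Poly_Mapping.keys_add[of "c * x" y] by auto
    then obtain s t where "s \<in> Poly_Mapping.keys c" "t \<in> Poly_Mapping.keys x" "m = s + t"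
      using keys_mult[of c x] by auto
    then show ?thesis using a by (auto simp: monomial_def split: if_splits)
  qed (use step.IH in auto)
qed

lemma single_in_monomial_ideal:
  assumes "a \<in> A"
  shows "(Poly_Mapping.single (c + a) k :: ('n, 'k::field) mpoly) \<in> ideal.span (monomial ` A)"
proof -
  have "(Poly_Mapping.single (c + a) k :: ('n, 'k) mpoly) = Poly_Mapping.single c k * monomial a"
    by (simp add: monomial_def mult_single)
  then show ?thesis
    using assms by (metis ideal.span_base ideal.span_scale imageI)
qed

lemma monomial_in_monomial_ideal_iff:
  "(monomial m :: ('n, 'k::field) mpoly) \<in> ideal.span (monomial ` A) \<longleftrightarrow> (\<exists>a\<in>A. \<exists>c. m = c + a)"
proof
  assume "(monomial m :: ('n, 'k) mpoly) \<in> ideal.span (monomial ` A)"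
  then show "\<exists>a\<in>A. \<exists>c. m = c + a"
    by (rule keys_in_monomial_ideal) (simp add: monomial_def)
next
  assume "\<exists>a\<in>A. \<exists>c. m = c + a"
  then show "(monomial m :: ('n, 'k) mpoly) \<in> ideal.span (monomial ` A)"
    using single_in_monomial_ideal[of _ A _ 1] by (auto simp: monomial_def)
qed

lemma ex1_minimal_monomial_generators:
  assumes "B \<subseteq> range (monomial :: 'n::finite expo \<Rightarrow> ('n, 'k::field) mpoly)"
  shows "\<exists>!G. is_minimal_monomial_generators (ideal.span B) G"
proof -
  let ?mon = "monomial :: 'n expo \<Rightarrow> ('n, 'k) mpoly"
  obtain A where A: "B = ?mon ` A" using assms by (meson subset_imageE)
  define D where "D = {a\<in>A. \<forall>b\<in>A. \<forall>c. a = c + b \<longrightarrow> b = a}"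
  have deg: "total_degree b < total_degree a" if "a = c + b" "b \<noteq> a" for a b c :: "'n expo"
  proof -
    have "c \<noteq> 0" using that by auto
    then obtain i where "Poly_Mapping.lookup c i \<noteq> 0" by (metis poly_mapping_eqI lookup_zero)
    then have "0 < total_degree c" unfolding total_degree_def
      by (metis UNIV_I finite not_gr_zero sum_eq_0_iff)
    then show ?thesis using that by (simp add: total_degree_def lookup_add sum.distrib)
  qed
  have below: "\<exists>b\<in>D. \<exists>c. a = c + b" if "a \<in> A" for a
    using that
  proof (induction "total_degree a" arbitrary: a rule: less_induct)
    case less
    show ?case
    proof (cases "a \<in> D")
      case True
      then show ?thesis by (metis add_0)
    next
      case False
      then obtain b c where b: "b \<in> A" "a = c + b" "b \<noteq> a" using less.prems D_def by auto
      then obtain b' c' where "b' \<in> D" "b = c' + b'" using less.hyps[OF deg[OF b(2,3)] b(1)] by auto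
      then show ?thesis using b by (metis add.assoc)
    qed
  qed
  have D_sub: "D \<subseteq> A" by (auto simp: D_def)
  have span_D: "ideal.span (?mon ` D) = ideal.span B"
  proof (rule antisym)
    show "ideal.span (?mon ` D) \<subseteq> ideal.span B"
      unfolding A using D_sub by (intro ideal.span_mono image_mono)
    show "ideal.span B \<subseteq> ideal.span (?mon ` D)"
      unfolding A by (intro ideal.span_minimal)
        (auto simp: monomial_in_monomial_ideal_iff below ideal.subspace_span)
  qed
  have D_in: "D \<subseteq> E" if "ideal.span (?mon ` E) = ideal.span B" for E
  proof
    fix a assume a: "a \<in> D"
    then have "?mon a \<in> ideal.span (?mon ` E)"
      using that D_sub A by (metis ideal.span_base imageI subsetD)
    then obtain e c where e: "e \<in> E" "a = c + e"
      by (auto simp: monomial_in_monomial_ideal_iff)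
    then have "?mon e \<in> ideal.span (?mon ` A)"
      using that A by (metis ideal.span_base imageI)
    then obtain b c' where b: "b \<in> A" "e = c' + b"
      by (auto simp: monomial_in_monomial_ideal_iff)
    then have ba: "b = a" using a e unfolding D_def by (auto simp: add.assoc[symmetric])
    have "e = a"
    proof (rule ccontr)
      assume "e \<noteq> a"
      then show False using deg[OF e(2)] deg[OF b(2)] ba by (metis less_asym)
    qed
    then show "a \<in> E" using e by simp
  qed
  show ?thesis
  proof (rule ex1I)
    show "is_minimal_monomial_generators (ideal.span B) (?mon ` D)"
      unfolding is_minimal_monomial_generators_def
    proof (intro conjI allI impI)
      fix H assume H: "H \<subset> ?mon ` D"
      then obtain E where "H = ?mon ` E" by (meson psubset_imp_subset subset_imageE)
      then show "ideal.span H \<noteq> ideal.span B" using D_in[of E] H by blast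
    qed (use span_D in auto)
  next
    fix G assume G: "is_minimal_monomial_generators (ideal.span B) G"
    then obtain E where E: "G = ?mon ` E"
      unfolding is_minimal_monomial_generators_def by (meson subset_imageE)
    then have "?mon ` D \<subseteq> G"
      using G D_in[of E] unfolding is_minimal_monomial_generators_def by blast
    then show "G = ?mon ` D"
      using G span_D unfolding is_minimal_monomial_generators_def by blast
  qed
qed

lemma multigraded_module_ideal:
  assumes "finite B" "B \<subseteq> range (monomial :: 'n::finite expo \<Rightarrow> ('n, 'k::field) mpoly)"
    and nz: "ideal.span B \<noteq> {0}"
  shows "multigraded_module (*) (ideal.span B) (\<lambda>a. ideal.span B \<inter> poly_comp a)"
proof (unfold_locales, goal_cases)
  case 1
  show ?case by (rule ideal.subspace_span)
next
  case 2
  show ?case by (rule nz)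
next
  case 3
  show ?case using assms(1) by blast
next
  case (4 a)
  show ?case by blast
next
  case (5 a)
  show ?case by (simp add: poly_comp_def ideal.span_zero)
next
  case (6 u a v)
  then show ?case using Poly_Mapping.keys_add[of u v]
    by (auto simp: poly_comp_def ideal.span_add)
next
  case (7 u a b c)
  then show ?case using keys_mult[of "Poly_Mapping.single b c" u]
    by (fastforce simp: poly_comp_def ideal.span_scale lookup_add split: if_splits)
next
  case (8 x)
  let ?mon = "monomial :: 'n expo \<Rightarrow> ('n, 'k) mpoly"
  obtain A where A: "B = ?mon ` A" using assms(2) by (meson subset_imageE)
  define v :: "'n expo \<Rightarrow> 'n \<Rightarrow> int" where "v = (\<lambda>m i. int (Poly_Mapping.lookup m i))"
  have inj_v: "inj v" unfolding v_def inj_def by (metis of_nat_eq_iff poly_mapping_eqI)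
  have comp_v: "p \<in> poly_comp a \<longleftrightarrow> (\<forall>m. Poly_Mapping.lookup p m \<noteq> 0 \<longrightarrow> v m = a)"
    for p :: "('n, 'k) mpoly" and a
    unfolding poly_comp_def v_def by (auto simp: in_keys_iff fun_eq_iff)
  have part: "Poly_Mapping.lookup (\<Sum>a | f a \<noteq> 0. f a) m = Poly_Mapping.lookup (f (v m)) m"
    if f: "finite {a. f a \<noteq> 0}" "\<forall>a. f a \<in> poly_comp a"
    for f :: "('n \<Rightarrow> int) \<Rightarrow> ('n, 'k) mpoly" and m
  proof -
    have "Poly_Mapping.lookup (f a) m = 0" if "a \<noteq> v m" for a
      using f(2) that by (auto simp: comp_v)
    then have "(\<Sum>a | f a \<noteq> 0. Poly_Mapping.lookup (f a) m)
        = (\<Sum>a\<in>{a. f a \<noteq> 0} \<inter> {v m}. Poly_Mapping.lookup (f a) m)"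
      using f(1) by (intro sum.mono_neutral_right) auto
    also have "\<dots> = Poly_Mapping.lookup (f (v m)) m"
      by (cases "f (v m) = 0") auto
    finally show ?thesis by (simp add: lookup_sum)
  qed
  define f where "f = (\<lambda>a. if a \<in> v ` Poly_Mapping.keys x
    then Poly_Mapping.single (inv v a) (Poly_Mapping.lookup x (inv v a)) else 0)"
  have f_v: "f (v m) = Poly_Mapping.single m (Poly_Mapping.lookup x m)" for m
    unfolding f_def using inj_v by (auto simp: inj_image_mem_iff in_keys_iff)
  have f_out: "f a = 0" if "a \<notin> range v" for a
    using that by (auto simp: f_def)
  have f_fin: "finite {a. f a \<noteq> 0}"
    by (rule finite_subset[of _ "v ` Poly_Mapping.keys x"]) (auto simp: f_def)
  have f_comp: "\<forall>a. f a \<in> poly_comp a"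
    unfolding comp_v
  proof (intro allI impI)
    fix a m assume "Poly_Mapping.lookup (f a) m \<noteq> 0"
    then show "v m = a"
      by (cases "a \<in> range v") (auto simp: f_v f_out lookup_single when_def split: if_splits)
  qed
  have f_span: "f a \<in> ideal.span B" for a
  proof (cases "a \<in> v ` Poly_Mapping.keys x")
    case True
    then obtain m where m: "a = v m" "m \<in> Poly_Mapping.keys x" by auto
    then obtain b c where "b \<in> A" "m = c + b"
      using keys_in_monomial_ideal[of x A m] 8 A by auto
    then show ?thesis using single_in_monomial_ideal[of b A] m f_v A by auto
  qed (simp add: f_def ideal.span_zero)
  show ?case
  proof (rule ex1I[of _ f])
    have "x = (\<Sum>a | f a \<noteq> 0. f a)"
      by (rule poly_mapping_eqI) (simp add: part[OF f_fin f_comp] f_v)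
    then show "finite {a. f a \<noteq> 0} \<and> (\<forall>a. f a \<in> ideal.span B \<inter> poly_comp a) \<and>
        x = (\<Sum>a | f a \<noteq> 0. f a)"
      using f_fin f_comp f_span by auto
  next
    fix g assume g: "finite {a. g a \<noteq> 0} \<and> (\<forall>a. g a \<in> ideal.span B \<inter> poly_comp a) \<and>
        x = (\<Sum>a | g a \<noteq> 0. g a)"
    have g_lookup: "Poly_Mapping.lookup x m = Poly_Mapping.lookup (g (v m)) m" for m
      using part[of g m] g by auto
    show "g = f"
    proof (intro ext poly_mapping_eqI)
      fix a m
      show "Poly_Mapping.lookup (g a) m = Poly_Mapping.lookup (f a) m"
      proof (cases "v m = a")
        case True
        then show ?thesis using g_lookup[of m] f_v[of m] by auto
      next
        case False
        then show ?thesis using g f_comp comp_v by (metis IntD2)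
      qed
    qed
  qed
qed

end

theory Submission
  imports Defs
begin

text \<open>
  Let \<open>P\<close> be the up-set of those \<open>F\<close> for which the squarefree monomial \<open>x\<^sub>F\<close> lies in \<open>I\<close>. A partition
  of \<open>P\<close> into intervals \<open>[C, D]\<close> yields a Stanley decomposition of \<open>I\<close> with the summands
  \<open>x\<^sub>C K[D]\<close>. The number of \<open>d\<close>-sets in \<open>P\<close> is at most \<open>\<mu>\<^sub>d(I)\<close>, and it suffices to match them
  injectively with \<open>(d + 1)\<close>-sets containing them and to take singleton intervals elsewhere.
  By Hall's theorem such a matching exists if every family of at most
  \<open>\<Sum>\<^sub>j binomial(2j - 1, j)\<close> sets of size \<open>k = n - d\<close> (the complements) has a shadow at least as
  large as itself. This follows from the Kruskal-Katona theorem, itself a consequence of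
  Frankl's shifting argument: a cascade below \<open>binomial(2k - 1, k)\<close> obeys the local LYM inequality, and a
  larger one has leading term \<open>binomial(2k - 1, k) = binomial(2k - 1, k - 1)\<close>, which can be removed.
\<close>

subsection \<open>Cascade representations\<close>

text \<open>
  \<open>cascade k A m s\<close>: there are \<open>A > a\<^sub>k > a\<^sub>k\<^sub>-\<^sub>1 > \<dots>\<close> with \<open>a\<^sub>j \<ge> j \<ge> 1\<close>, the last index being
  arbitrary, such that \<open>m = \<Sum>\<^sub>j binomial(a\<^sub>j, j)\<close> and \<open>s = \<Sum>\<^sub>j binomial(a\<^sub>j, j - 1)\<close>.
\<close>

inductive cascade :: "nat \<Rightarrow> nat \<Rightarrow> nat \<Rightarrow> nat \<Rightarrow> bool" where
  cascade_0: "cascade k A 0 0"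
| cascade_Suc: "cascade (Suc k) A ((a choose Suc k) + m) ((a choose k) + s)"
    if "cascade k a m s" "Suc k \<le> a" "a < A"

lemma cascade_mono: "cascade k A m s \<Longrightarrow> A \<le> B \<Longrightarrow> cascade k B m s"
  by (induction arbitrary: B rule: cascade.induct) (auto intro: cascade.intros)

lemma cascade_index_0: "cascade 0 A m s \<Longrightarrow> m = 0 \<and> s = 0"
  by (auto elim: cascade.cases)

lemma cascade_value_0: "cascade k A 0 s \<Longrightarrow> s = 0"
  by (auto elim: cascade.cases)

text \<open>By induction the tail lies below \<open>a choose k\<close>, so Pascal's rule keeps the
  whole value below \<open>Suc a choose Suc k\<close>.\<close>

lemma cascade_value_less: "cascade k A m s \<Longrightarrow> k \<le> A \<Longrightarrow> m < A choose k"
proof (induction rule: cascade.induct)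
  case (cascade_Suc k a m s A)
  have "(a choose Suc k) + m < (a choose Suc k) + (a choose k)"
    using cascade_Suc by simp
  also have "\<dots> = Suc a choose Suc k" by simp
  also have "\<dots> \<le> A choose Suc k"
    using cascade_Suc by (intro binomial_right_mono) auto
  finally show ?case .
qed auto

text \<open>
  Replacing each \<open>a\<^sub>j\<close> by \<open>a\<^sub>j - 1\<close> and applying Pascal's rule splits \<open>m\<close> and \<open>s\<close>. The numbers \<open>a\<^sub>j - 1\<close>
  need not satisfy \<open>a\<^sub>j - 1 \<ge> j\<close>, so only a value slightly above \<open>m1\<close> has a cascade, with
  shadow at least \<open>s1\<close>; and \<open>t\<close> may be smaller than \<open>s1\<close> because a term with lower index 0 is lost.
\<close>

lemma cascade_decrement:
  assumes "cascade k A m s"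
  shows "\<exists>m1 s1 s2. m = m1 + s1 \<and> s = s1 + s2 \<and> (A \<le> Suc k \<longrightarrow> s1 \<le> k) \<and>
    (\<exists>t\<le>s1. cascade (k - 1) (A - 1) t s2) \<and>
    (\<exists>m'\<le>Suc m1. \<exists>s'\<ge>s1. cascade k (max (A - 1) (Suc k)) m' s')"
  using assms
proof (induction rule: cascade.induct)
  case (cascade_0 k A)
  show ?case by (auto intro: cascade.cascade_0 exI[of _ 0])
next
  case (cascade_Suc k a m s A)
  then obtain b where b: "a = Suc b" by (cases a) auto
  obtain m1 s1 s2 t m' s' where IH: "m = m1 + s1" "s = s1 + s2" "a \<le> Suc k \<longrightarrow> s1 \<le> k"
    "t \<le> s1" "cascade (k - 1) b t s2" "m' \<le> Suc m1" "s1 \<le> s'" "cascade k (max b (Suc k)) m' s'"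
    using cascade_Suc.IH b by auto
  \<comment> \<open>At \<open>k = 0\<close> nothing is left of \<open>a choose 0\<close> after
    taking away \<open>b choose 0\<close>, whereas truncated subtraction would make
    \<open>b choose (k - 1)\<close> equal to 1.\<close>
  define s2' where "s2' = (if k = 0 then 0 else b choose (k - 1)) + s2"
  have m: "(a choose Suc k) + m = ((b choose Suc k) + m1) + ((b choose k) + s1)"
    using b IH by simp
  have s: "(a choose k) + s = ((b choose k) + s1) + s2'"
    using b IH by (cases k) (auto simp: s2'_def)
  have small: "A \<le> Suc (Suc k) \<longrightarrow> (b choose k) + s1 \<le> Suc k"
    using b IH cascade_Suc.hyps by (auto simp: le_Suc_eq)
  have down: "\<exists>t\<le>(b choose k) + s1. cascade k (A - 1) t s2'"
  proof (cases k)
    case 0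
    then show ?thesis
      using IH(5) cascade_index_0[of b t s2] cascade.cascade_0[of 0 "A - 1"]
      by (intro exI[of _ 0]) (auto simp: s2'_def)
  next
    case (Suc k')
    then have "cascade (Suc k') (A - 1) ((b choose Suc k') + t) ((b choose k') + s2)"
      using IH b cascade_Suc.hyps by (intro cascade.cascade_Suc) auto
    then show ?thesis using Suc IH by (auto simp: s2'_def intro!: exI[of _ "(b choose k) + t"])
  qed
  have next_one: "\<exists>m''\<le>Suc ((b choose Suc k) + m1). \<exists>s''\<ge>(b choose k) + s1.
      cascade (Suc k) (max (A - 1) (Suc (Suc k))) m'' s''"
  proof (cases "Suc k \<le> b")
    case True
    then have "cascade (Suc k) (max (A - 1) (Suc (Suc k))) ((b choose Suc k) + m') ((b choose k) + s')"
      using IH b cascade_Suc.hyps by (intro cascade.cascade_Suc) (auto simp: max_def)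
    then show ?thesis using IH
      by (intro exI[of _ "(b choose Suc k) + m'"] conjI exI[of _ "(b choose k) + s'"]) auto
  next
    case False
    \<comment> \<open>The lowered leading term \<open>b choose Suc k\<close> vanishes. The one-term
      cascade of value 1 takes its place: its shadow value \<open>Suc k\<close> is large enough
      because \<open>a = Suc k\<close> gives \<open>s1 \<le> k\<close>, which is the purpose of the
      clause on \<open>A \<le> Suc k\<close>.\<close>
    then have bk: "b = k" using b cascade_Suc.hyps by auto
    have "cascade (Suc k) (max (A - 1) (Suc (Suc k))) ((Suc k choose Suc k) + 0) ((Suc k choose k) + 0)"
      by (intro cascade.intros) auto
    then show ?thesis using bk b IH
      by (intro exI[of _ "1"] conjI exI[of _ "Suc k"]) (auto simp del: binomial_Suc_Suc)
  qed
  show ?case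
    using m s small down next_one
    by (intro exI[of _ "(b choose Suc k) + m1"] exI[of _ "(b choose k) + s1"] exI[of _ s2']) simp
qed

text \<open>Greedy choice: if \<open>m\<close> is not below \<open>n choose k\<close>, take
  \<open>n\<close> as the leading entry; by Pascal's rule the remainder is below
  \<open>n choose (k - 1)\<close>.\<close>

lemma cascade_exists: "m < n choose k \<Longrightarrow> \<exists>s. cascade k n m s"
proof (induction n arbitrary: k m)
  case 0
  then show ?case by (cases k) (auto intro: cascade_0)
next
  case (Suc n)
  show ?case
  proof (cases k)
    case 0
    then show ?thesis using Suc.prems by (auto intro: cascade_0)
  next
    case (Suc k')
    show ?thesis
    proof (cases "m < n choose k")
      case True
      then show ?thesis using Suc.IH[of m k] cascade_mono[of k n m _ "Suc n"] by auto
    next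
      case False
      then obtain m' where m': "m = (n choose Suc k') + m'" "m' < n choose k'"
        using Suc.prems Suc le_Suc_ex[of "n choose k" m] by auto
      then obtain s where s: "cascade k' n m' s" using Suc.IH by blast
      show ?thesis
      proof (cases "k \<le> n")
        case True
        then show ?thesis using s m' Suc cascade_Suc[OF s] by auto
      next
        case False
        then have "n choose Suc k' = 0" "n choose k' \<le> 1" using Suc
          by (auto simp: not_le less_Suc_eq binomial_eq_0)
        then have "m = 0" using m' by simp
        then show ?thesis by (auto intro: cascade_0)
      qed
    qed
  qed
qed

text \<open>The leading term satisfies the inequality with equality and factor \<open>a - k\<close>,
  the tail with factor \<open>a - k + 1\<close>. The extra copy of \<open>m\<close> is at most
  \<open>a choose k\<close>, which raises the first factor to match the second.\<close>

lemma cascade_local_LYM: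
  "cascade k A m s \<Longrightarrow> k \<le> A \<Longrightarrow> k * m \<le> (A - k + 1) * s"
proof (induction rule: cascade.induct)
  case (cascade_Suc k a m s A)
  have m_le: "m \<le> a choose k" using cascade_value_less[of k a m s] cascade_Suc by auto
  obtain e where e: "a = Suc k + e" using cascade_Suc.hyps le_Suc_ex by blast
  have binom: "Suc k * (a choose Suc k) = (e + 1) * (a choose k)"
    using binomial_absorb_comp[of a k] binomial_absorption[of k a] e
    by (simp del: binomial_Suc_Suc mult_Suc)
  have IH: "k * m \<le> (e + 2) * s" using cascade_Suc e by simp
  have "Suc k * ((a choose Suc k) + m) = (e + 1) * (a choose k) + (k * m + m)"
    using binom by (simp add: algebra_simps)
  also have "\<dots> \<le> (e + 1) * (a choose k) + ((e + 2) * s + (a choose k))"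
    using IH m_le by simp
  also have "\<dots> = (e + 2) * ((a choose k) + s)" by (simp add: algebra_simps)
  also have "\<dots> \<le> (A - Suc k + 1) * ((a choose k) + s)"
    using cascade_Suc.hyps e by (intro mult_right_mono) auto
  finally show ?case .
qed auto

text \<open>The bound \<open>2 * k\<close> leaves room for the leading entry
  \<open>2 * k - 1\<close>, and keeps the cascade of a remainder below the leading entry
  \<open>2 * k + 1\<close> of the next index.\<close>

lemma cascade_shadow_ge:
  assumes "m \<le> (\<Sum>j = 1..k. (2 * j - 1) choose j)"
  shows "\<exists>s\<ge>m. cascade k (2 * k) m s"
  using assms
proof (induction k arbitrary: m)
  case 0
  then show ?case by (auto intro: cascade_0)
next
  case (Suc k)
  let ?a = "2 * k + 1"
  have sym: "?a choose Suc k = ?a choose k" using binomial_symmetric[of k ?a] by simp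
  show ?case
  proof (cases "m < ?a choose Suc k")
    case True
    then obtain s where s: "cascade (Suc k) ?a m s" using cascade_exists by blast
    \<comment> \<open>The local LYM factor is \<open>(2 * k + 1) - Suc k + 1 = Suc k\<close>, so it
      cancels.\<close>
    then have "Suc k * m \<le> Suc k * s" using cascade_local_LYM[OF s] by simp
    then have "m \<le> s" by (metis Suc_mult_le_cancel1)
    then show ?thesis using cascade_mono[OF s] by auto
  next
    case False
    then obtain m' where m': "m = (?a choose Suc k) + m'"
      by (metis le_Suc_ex not_less)
    then have "m' \<le> (\<Sum>j = 1..k. (2 * j - 1) choose j)" using Suc.prems by simp
    then obtain s where s: "m' \<le> s" "cascade k (2 * k) m' s" using Suc.IH by blast
    have "cascade (Suc k) (2 * Suc k) m ((?a choose k) + s)"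
      unfolding m' using cascade_mono[OF s(2)] by (intro cascade_Suc) auto
    then show ?thesis using m' s(1) sym by (intro exI[of _ "(?a choose k) + s"]) simp
  qed
qed

subsection \<open>Shifting and the Kruskal-Katona theorem\<close>

definition shadow :: "'a set set \<Rightarrow> 'a set set" where
  "shadow \<F> = {E. \<exists>x. x \<notin> E \<and> insert x E \<in> \<F>}"

lemma shadow_subset_Pow: "\<F> \<subseteq> Pow V \<Longrightarrow> shadow \<F> \<subseteq> Pow V"
  by (auto simp: shadow_def)

text \<open>The compression of Erdos, Ko and Rado: \<open>y\<close> is exchanged for
  \<open>x\<close> unless the result is already present, which keeps the map injective.\<close>

definition shift :: "'a \<Rightarrow> 'a \<Rightarrow> 'a set set \<Rightarrow> 'a set set" where
  "shift x y \<F> = (\<lambda>F. if y \<in> F \<and> x \<notin> F \<and> insert x (F - {y}) \<notin> \<F>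
     then insert x (F - {y}) else F) ` \<F>"

text \<open>Exchanging \<open>x\<close> and \<open>y\<close> pairs up the sets that contain exactly
  one of them. The shift preserves how many sets of each pair are present and fills the side of
  \<open>x\<close> first.\<close>

lemma mem_shift_iff:
  assumes "x \<noteq> y"
  shows "F \<in> shift x y \<F> \<longleftrightarrow>
    (if x \<in> F \<and> y \<notin> F then F \<in> \<F> \<or> insert y (F - {x}) \<in> \<F>
     else if y \<in> F \<and> x \<notin> F then F \<in> \<F> \<and> insert x (F - {y}) \<in> \<F>
     else F \<in> \<F>)"
proof -
  have *: "insert y (insert x (G - {y}) - {x}) = G" if "y \<in> G" "x \<notin> G" for G
    using that assms by auto
  have **: "insert x (insert y (G - {x}) - {y}) = G" if "x \<in> G" "y \<notin> G" for G
    using that assms by auto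
  show ?thesis
  proof
    assume "F \<in> shift x y \<F>"
    then show "if x \<in> F \<and> y \<notin> F then F \<in> \<F> \<or> insert y (F - {x}) \<in> \<F>
     else if y \<in> F \<and> x \<notin> F then F \<in> \<F> \<and> insert x (F - {y}) \<in> \<F>
     else F \<in> \<F>"
      unfolding shift_def
    proof (rule imageE)
      fix G assume G: "F = (if y \<in> G \<and> x \<notin> G \<and> insert x (G - {y}) \<notin> \<F> then insert x (G - {y}) else G)"
        "G \<in> \<F>"
      then show ?thesis using *[of G] assms by (cases "y \<in> G \<and> x \<notin> G \<and> insert x (G - {y}) \<notin> \<F>") auto
    qed
  next
    assume R: "if x \<in> F \<and> y \<notin> F then F \<in> \<F> \<or> insert y (F - {x}) \<in> \<F>
     else if y \<in> F \<and> x \<notin> F then F \<in> \<F> \<and> insert x (F - {y}) \<in> \<F>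
     else F \<in> \<F>"
    let ?s = "\<lambda>F. if y \<in> F \<and> x \<notin> F \<and> insert x (F - {y}) \<notin> \<F> then insert x (F - {y}) else F"
    show "F \<in> shift x y \<F>"
    proof (cases "F \<in> \<F>")
      case True
      then have "\<not> (y \<in> F \<and> x \<notin> F \<and> insert x (F - {y}) \<notin> \<F>)"
        using R by meson
      then have "F = ?s F" by (rule if_not_P[symmetric])
      then show ?thesis unfolding shift_def using True by (rule image_eqI)
    next
      case False
      then have F: "x \<in> F" "y \<notin> F" "insert y (F - {x}) \<in> \<F>" using R by (auto split: if_splits)
      have "y \<in> insert y (F - {x}) \<and> x \<notin> insert y (F - {x}) \<and>
          insert x (insert y (F - {x}) - {y}) \<notin> \<F>"
        using **[OF F(1,2)] False assms by simp
      then have "?s (insert y (F - {x})) = insert x (insert y (F - {x}) - {y})" by (rule if_P)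
      also have "\<dots> = F" using **[OF F(1,2)] .
      finally have "F = ?s (insert y (F - {x}))" by (rule sym)
      then show ?thesis unfolding shift_def using F(3) by (rule image_eqI)
    qed
  qed
qed

text \<open>Moved sets land outside \<open>\<F>\<close>, and the exchange of \<open>y\<close> for
  \<open>x\<close> can be undone.\<close>

lemma card_shift:
  assumes "x \<noteq> y"
  shows "card (shift x y \<F>) = card \<F>"
  unfolding shift_def
proof (intro card_image inj_onI)
  have *: "F = G" if "insert x (F - {y}) = insert x (G - {y})" "x \<notin> F" "x \<notin> G" "y \<in> F" "y \<in> G" for F G
  proof -
    have "F = insert y (insert x (F - {y}) - {x})" using that(2,4) assms by auto
    also have "\<dots> = insert y (insert x (G - {y}) - {x})" by (simp only: that(1))
    also have "\<dots> = G" using that(3,5) assms by auto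
    finally show ?thesis .
  qed
  fix F G
  assume "F \<in> \<F>" "G \<in> \<F>"
    "(if y \<in> F \<and> x \<notin> F \<and> insert x (F - {y}) \<notin> \<F> then insert x (F - {y}) else F) =
     (if y \<in> G \<and> x \<notin> G \<and> insert x (G - {y}) \<notin> \<F> then insert x (G - {y}) else G)"
  then show "F = G" using *[of F G] by metis
qed

text \<open>Membership in a shift depends only on a set and its exchange partner, so the cases are
  which of \<open>x\<close>, \<open>y\<close> lie in \<open>E\<close>. Adding another element
  \<open>e\<close> commutes with the exchange.\<close>

lemma shadow_shift_subset:
  assumes "x \<noteq> y"
  shows "shadow (shift x y \<F>) \<subseteq> shift x y (shadow \<F>)"
proof
  fix E assume "E \<in> shadow (shift x y \<F>)"
  then obtain e where e: "e \<notin> E" "insert e E \<in> shift x y \<F>" by (auto simp: shadow_def)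
  have sh: "E' \<in> shadow \<F>" if "insert z E' \<in> \<F>" "z \<notin> E'" for E' z
    using that by (auto simp: shadow_def)
  note mem = mem_shift_iff[OF assms]
  consider "x \<in> E" "y \<notin> E" | "y \<in> E" "x \<notin> E" | "x \<in> E" "y \<in> E" | "x \<notin> E" "y \<notin> E" by blast
  then show "E \<in> shift x y (shadow \<F>)"
  proof cases
    case 1
    then consider "insert e E \<in> \<F>" | "e \<noteq> y" "insert y (insert e E - {x}) \<in> \<F>"
      using e mem[of "insert e E"] by (auto split: if_splits)
    then show ?thesis
    proof cases
      case 2
      then have "insert e (insert y (E - {x})) \<in> \<F>"
        using e 1 by (metis insert_Diff_if insert_commute singletonD)
      then show ?thesis using sh[of e "insert y (E - {x})"] e 1 2 mem[of E] by auto
    qed (use sh[of e E] e 1 mem[of E] in auto)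
  next
    case 2
    show ?thesis
    proof (cases "e = x")
      case True
      \<comment> \<open>This set contains both \<open>x\<close> and \<open>y\<close>, so it was not
        moved. Deleting \<open>x\<close> gives \<open>E\<close> and deleting \<open>y\<close> gives
        its partner, and both must lie in the shadow.\<close>
      then have "insert y (insert x (E - {y})) \<in> \<F>"
        using e 2 mem[of "insert e E"] by (simp add: insert_absorb insert_commute)
      then show ?thesis
        using e 2 True sh[of x E] sh[of y "insert x (E - {y})"] mem[of E] mem[of "insert e E"] assms by simp
    next
      case False
      then have "insert e E \<in> \<F>" "insert x (insert e E - {y}) \<in> \<F>"
        using e 2 mem[of "insert e E"] by auto
      moreover have "insert x (insert e E - {y}) = insert e (insert x (E - {y}))"
        using e 2 by auto
      ultimately show ?thesis
        using e 2 False sh[of e E] sh[of e "insert x (E - {y})"] mem[of E] by simp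
    qed
  next
    case 3
    then show ?thesis using e sh[of e E] mem[of E] mem[of "insert e E"] by simp
  next
    case 4
    \<comment> \<open>The exchange does not affect \<open>E\<close>, so it is enough to be in the
      shadow of \<open>\<F>\<close>. For \<open>e = x\<close> the witness is
      \<open>insert x E\<close> or, if that set is new, \<open>insert y E\<close>.\<close>
    consider "e = x" | "e = y" | "e \<noteq> x" "e \<noteq> y" by blast
    then have "E \<in> shadow \<F>"
    proof cases
      case 1
      then show ?thesis
        using 4 e sh[of x E] sh[of y E] mem[of "insert e E"] assms by auto
    next
      case 2
      then show ?thesis using 4 e sh[of e E] mem[of "insert e E"] assms by simp
    next
      case 3
      then show ?thesis using 4 e sh[of e E] mem[of "insert e E"] by auto
    qed
    then show ?thesis using 4 mem[of E] by simp
  qed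
qed

text \<open>Extremal argument: among the finitely many families with the first four properties, take
  one with the most members containing \<open>x\<close>. A further shift towards \<open>x\<close>
  that changed it would increase this number.\<close>

lemma exists_shifted:
  assumes V: "finite V" "x \<in> V" and \<F>: "\<F> \<subseteq> Pow V" "\<forall>F\<in>\<F>. card F = k"
  obtains \<G> where "\<G> \<subseteq> Pow V" "\<forall>F\<in>\<G>. card F = k" "card \<G> = card \<F>"
    "card (shadow \<G>) \<le> card (shadow \<F>)"
    "\<And>F y. F \<in> \<G> \<Longrightarrow> y \<in> F \<Longrightarrow> x \<notin> F \<Longrightarrow> insert x (F - {y}) \<in> \<G>"
proof -
  define \<A> where "\<A> = {\<G>. \<G> \<subseteq> Pow V \<and> (\<forall>F\<in>\<G>. card F = k) \<and> card \<G> = card \<F> \<and>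
    card (shadow \<G>) \<le> card (shadow \<F>)}"
  define w where "w = (\<lambda>\<G>::'a set set. card {F\<in>\<G>. x \<in> F})"
  have fin: "finite \<A>"
    by (rule finite_subset[of _ "Pow (Pow V)"]) (use V in \<open>auto simp: \<A>_def\<close>)
  moreover have "\<F> \<in> \<A>" using \<F> by (auto simp: \<A>_def)
  ultimately obtain \<G> where \<G>: "\<G> \<in> \<A>" and max: "\<And>\<H>. \<H> \<in> \<A> \<Longrightarrow> w \<H> \<le> w \<G>"
    using Max_in[of "w ` \<A>"] Max_ge[of "w ` \<A>"] by (metis (mono_tags, lifting) empty_iff finite_imageI image_iff)
  have finPow: "finite \<H>" if "\<H> \<subseteq> Pow V" for \<H> using that V finite_subset by blast
  have "insert x (F - {y}) \<in> \<G>" if F: "F \<in> \<G>" "y \<in> F" "x \<notin> F" for F y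
  proof (rule ccontr)
    assume new: "insert x (F - {y}) \<notin> \<G>"
    have xy: "x \<noteq> y" using F by auto
    have sub: "shift x y \<G> \<subseteq> Pow V" using \<G> V by (auto simp: shift_def \<A>_def split: if_splits)
    have "card (insert x (F - {y})) = k" if "F \<in> \<G>" "y \<in> F" "x \<notin> F" for F
    proof -
      have "finite F" using that \<G> V finite_subset by (auto simp: \<A>_def)
      then have "card (insert x (F - {y})) = card F"
        using that card_Suc_Diff1[of F y] by simp
      then show ?thesis using that \<G> by (auto simp: \<A>_def)
    qed
    then have "\<forall>F\<in>shift x y \<G>. card F = k"
      using \<G> by (auto simp: shift_def \<A>_def split: if_splits)
    moreover have "card (shadow (shift x y \<G>)) \<le> card (shadow \<G>)"
    proof -
      have "shift x y (shadow \<G>) \<subseteq> Pow V"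
        using \<G> V shadow_subset_Pow[of \<G> V] by (auto simp: shift_def \<A>_def split: if_splits)
      then have "card (shadow (shift x y \<G>)) \<le> card (shift x y (shadow \<G>))"
        using finPow shadow_shift_subset[OF xy] by (intro card_mono) auto
      then show ?thesis using card_shift[OF xy] by metis
    qed
    ultimately have "shift x y \<G> \<in> \<A>"
      using \<G> sub card_shift[OF xy, of \<G>] by (auto simp: \<A>_def)
    moreover have "w \<G> < w (shift x y \<G>)"
      unfolding w_def
    proof (rule psubset_card_mono)
      show "finite {F \<in> shift x y \<G>. x \<in> F}" using sub finPow by simp
      have "insert x (F - {y}) \<in> shift x y \<G>"
        using F xy by (simp add: mem_shift_iff[OF xy] insert_absorb)
      moreover have "G \<in> shift x y \<G>" if "G \<in> \<G>" "x \<in> G" for G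
        using that by (auto simp: mem_shift_iff[OF xy])
      ultimately show "{F \<in> \<G>. x \<in> F} \<subset> {F \<in> shift x y \<G>. x \<in> F}" using new by blast
    qed
    ultimately show False using max[of "shift x y \<G>"] by simp
  qed
  then show thesis using \<G> that[of \<G>] by (auto simp: \<A>_def)
qed

text \<open>Induction on the ground set: a shifted family splits into the members avoiding
  \<open>x\<close> and the link of \<open>x\<close>. The link contributes itself and its shadow to
  the shadow of the family, and these two parts account for \<open>s1\<close> and \<open>s2\<close>
  of the decremented cascade.\<close>

theorem Kruskal_Katona:
  assumes "finite V" "\<F> \<subseteq> Pow V" "\<forall>F\<in>\<F>. card F = k" "cascade k A m s" "m \<le> card \<F>"
  shows "s \<le> card (shadow \<F>)"
  using assms
proof (induction V arbitrary: \<F> k A m s rule: finite_induct)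
  case empty
  show ?case
  proof (cases k)
    case 0
    then show ?thesis using empty.prems(3) cascade_index_0[of A m s] by simp
  next
    case (Suc k')
    then have "\<F> = {}" using empty.prems(1,2) by fastforce
    then show ?thesis using empty cascade_value_0 by auto
  qed
next
  case (insert x V)
  obtain \<G> where \<G>: "\<G> \<subseteq> Pow (insert x V)" "\<forall>F\<in>\<G>. card F = k" "card \<G> = card \<F>"
    "card (shadow \<G>) \<le> card (shadow \<F>)"
    and shifted: "\<And>F y. F \<in> \<G> \<Longrightarrow> y \<in> F \<Longrightarrow> x \<notin> F \<Longrightarrow> insert x (F - {y}) \<in> \<G>"
    using exists_shifted[of "insert x V" x \<F> k] insert by blast
  obtain m1 s1 s2 t m' s' where c: "m = m1 + s1" "s = s1 + s2" "t \<le> s1"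
    "cascade (k - 1) (A - 1) t s2" "m' \<le> Suc m1" "s1 \<le> s'" "cascade k (max (A - 1) (Suc k)) m' s'"
    using cascade_decrement[OF insert.prems(3)] by blast
  have fin: "finite \<H>" if "\<H> \<subseteq> Pow (insert x V)" for \<H>
    using that insert.hyps(1) by (metis finite_Pow_iff finite_insert finite_subset)
  define B where "B = {F\<in>\<G>. x \<notin> F}"
  define C where "C = {E. x \<notin> E \<and> insert x E \<in> \<G>}"
  have B: "B \<subseteq> Pow V" "\<forall>F\<in>B. card F = k" using \<G> by (auto simp: B_def)
  have C: "C \<subseteq> Pow V" using \<G> by (auto simp: C_def)
  have C_card: "\<forall>F\<in>C. card F = k - 1"
  proof
    fix F assume F: "F \<in> C"
    then have "finite F" using C insert.hyps(1) finite_subset by blast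
    then show "card F = k - 1" using F \<G> by (force simp: C_def)
  qed
  have inj: "inj_on (insert x) \<H>" if "\<And>E. E \<in> \<H> \<Longrightarrow> x \<notin> E" for \<H>
    using that by (intro inj_onI) (metis insert_ident)
  have split: "\<G> = B \<union> insert x ` C"
  proof (intro equalityI subsetI)
    fix F assume F: "F \<in> \<G>"
    show "F \<in> B \<union> insert x ` C"
    proof (cases "x \<in> F")
      case True
      then have "F = insert x (F - {x})" by auto
      moreover from this have "F - {x} \<in> C" using F by (simp add: C_def)
      ultimately show ?thesis by blast
    qed (use F in \<open>simp add: B_def\<close>)
  qed (auto simp: B_def C_def)
  have "card \<G> = card B + card (insert x ` C)"
    unfolding split using B(1) C by (intro card_Un_disjoint finite_imageI fin) (auto simp: B_def)
  also have "card (insert x ` C) = card C"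
    by (intro card_image inj) (simp add: C_def)
  finally have card_\<G>: "card \<G> = card B + card C" .
  have shadow_C: "x \<notin> E" if "E \<in> shadow C" for E using that by (auto simp: C_def shadow_def)
  \<comment> \<open>Deleting \<open>x\<close> from a member gives an element of \<open>C\<close>;
    deleting another element from a member with \<open>x\<close> gives a set that still contains
    \<open>x\<close>.\<close>
  have "C \<union> insert x ` shadow C \<subseteq> shadow \<G>"
    by (auto simp: C_def shadow_def insert_commute)
  then have "card (C \<union> insert x ` shadow C) \<le> card (shadow \<G>)"
    using fin[OF shadow_subset_Pow[OF \<G>(1)]] card_mono by blast
  moreover have "card (C \<union> insert x ` shadow C) = card C + card (insert x ` shadow C)"
    using C shadow_subset_Pow[OF C] by (intro card_Un_disjoint finite_imageI fin) (auto simp: C_def)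
  moreover have "card (insert x ` shadow C) = card (shadow C)"
    using shadow_C by (intro card_image inj)
  ultimately have lower: "card C + card (shadow C) \<le> card (shadow \<G>)" by simp
  have "s1 \<le> card C"
  proof (rule ccontr)
    assume small: "\<not> s1 \<le> card C"
    \<comment> \<open>Failure is strict, so \<open>B\<close> has at least \<open>Suc m1\<close>
      members, which is why a cascade of a value up to \<open>Suc m1\<close> suffices.\<close>
    then have "m' \<le> card B" using c card_\<G> \<G> insert.prems(4) by simp
    then have "s' \<le> card (shadow B)" using insert.IH[OF B c(7)] by simp
    moreover have "shadow B \<subseteq> C"
    proof
      fix E assume "E \<in> shadow B"
      then obtain y where "y \<notin> E" "insert y E \<in> \<G>" "x \<notin> insert y E"
        by (auto simp: shadow_def B_def)
      then show "E \<in> C" using shifted[of "insert y E" y] by (auto simp: C_def)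
    qed
    then have "card (shadow B) \<le> card C" using C by (intro card_mono fin) auto
    ultimately show False using small c by simp
  qed
  moreover from this have "s2 \<le> card (shadow C)"
    using insert.IH[OF C C_card c(4)] c by simp
  ultimately show ?case using lower \<G> c by simp
qed

lemma card_le_card_shadow:
  assumes "finite V" "\<F> \<subseteq> Pow V" "\<forall>F\<in>\<F>. card F = k"
    and "card \<F> \<le> (\<Sum>j = 1..k. (2 * j - 1) choose j)"
  shows "card \<F> \<le> card (shadow \<F>)"
  using cascade_shadow_ge[OF assms(4)] Kruskal_Katona[OF assms(1-3)] by fastforce

subsection \<open>Matchings\<close>

text \<open>The Halmos-Vaughan induction. A tight proper subset is matched first and its neighbours
  are withdrawn from the rest; without one, every nonempty proper subset has a neighbour to spare,
  so an arbitrary pair can be fixed.\<close>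

theorem Hall:
  assumes "finite I" "\<And>i. i \<in> I \<Longrightarrow> finite (N i)"
    and "\<And>J. J \<subseteq> I \<Longrightarrow> card J \<le> card (\<Union>i\<in>J. N i)"
  shows "\<exists>f. inj_on f I \<and> (\<forall>i\<in>I. f i \<in> N i)"
  using assms
proof (induction "card I" arbitrary: I N rule: less_induct)
  case less
  note finI = less.prems(1) and finN = less.prems(2) and hall = less.prems(3)
  show ?case
  proof (cases "\<exists>J. J \<subset> I \<and> J \<noteq> {} \<and> card (\<Union>i\<in>J. N i) = card J")
    case True
    then obtain J where J: "J \<subset> I" "J \<noteq> {}" and tight: "card (\<Union>i\<in>J. N i) = card J" by blast
    define U where "U = (\<Union>i\<in>J. N i)"
    have "card J < card I" using J finI psubset_card_mono by blast
    then obtain f where f: "inj_on f J" "\<forall>i\<in>J. f i \<in> N i"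
      using less.hyps[of J N] J finN hall finI
      by (metis finite_subset psubset_imp_subset subset_iff)
    have "card (I - J) < card I"
      using J finI by (intro psubset_card_mono) auto
    moreover have "card K \<le> card (\<Union>i\<in>K. N i - U)" if K: "K \<subseteq> I - J" for K
    proof -
      have "card K + card J = card (K \<union> J)"
        using K J finI by (subst card_Un_disjoint) (auto intro: finite_subset)
      also have "\<dots> \<le> card (\<Union>i\<in>K \<union> J. N i)" using K J by (intro hall) auto
      also have "(\<Union>i\<in>K \<union> J. N i) = (\<Union>i\<in>K. N i - U) \<union> U" by (auto simp: U_def)
      also have "card \<dots> \<le> card (\<Union>i\<in>K. N i - U) + card U" by (rule card_Un_le)
      finally show ?thesis using tight by (simp add: U_def)
    qed
    ultimately obtain g where g: "inj_on g (I - J)" "\<forall>i\<in>I - J. g i \<in> N i - U"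
      using less.hyps[of "I - J" "\<lambda>i. N i - U"] finI finN by auto
    let ?h = "\<lambda>i. if i \<in> J then f i else g i"
    have f_U: "f i \<in> U" if "i \<in> J" for i using f(2) that by (auto simp: U_def)
    have g_U: "g i \<notin> U" if "i \<in> I" "i \<notin> J" for i using g(2) that by simp
    have "inj_on ?h I"
    proof (rule inj_onI)
      fix i j assume ij: "i \<in> I" "j \<in> I" "?h i = ?h j"
      then have "i \<in> J \<longleftrightarrow> j \<in> J" using f_U g_U by (metis (full_types))
      then show "i = j"
        using ij inj_onD[OF f(1), of i j] inj_onD[OF g(1), of i j] by (cases "i \<in> J") auto
    qed
    moreover have "\<forall>i\<in>I. ?h i \<in> N i" using f(2) g(2) by simp
    ultimately show ?thesis by (intro exI conjI)
  next
    case no_tight: False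
    show ?thesis
    proof (cases "I = {}")
      case False
      then obtain a where a: "a \<in> I" by blast
      have "card {a} \<le> card (N a)" using hall[of "{a}"] a by simp
      then obtain b where b: "b \<in> N a" by fastforce
      have "card (I - {a}) < card I" using a finI by (meson card_Diff1_less)
      moreover have "card K \<le> card (\<Union>i\<in>K. N i - {b})" if K: "K \<subseteq> I - {a}" for K
      proof (cases "K = {}")
        case False
        have "K \<subset> I" using K a by auto
        then have "card K \<le> card (\<Union>i\<in>K. N i)" "card (\<Union>i\<in>K. N i) \<noteq> card K"
          using False no_tight hall[of K] by blast+
        then have "card K < card (\<Union>i\<in>K. N i)" by simp
        moreover have "(\<Union>i\<in>K. N i - {b}) = (\<Union>i\<in>K. N i) - {b}" by auto
        ultimately show ?thesis by (auto simp: card_Diff_singleton_if)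
      qed simp
      ultimately obtain g where g: "inj_on g (I - {a})" "\<forall>i\<in>I - {a}. g i \<in> N i - {b}"
        using less.hyps[of "I - {a}" "\<lambda>i. N i - {b}"] finI finN by auto
      have "inj_on (g(a := b)) I"
      proof (rule inj_onI)
        fix i j assume "i \<in> I" "j \<in> I" "(g(a := b)) i = (g(a := b)) j"
        then show "i = j" using g inj_onD[OF g(1), of i j] by (cases "i = a"; cases "j = a") auto
      qed
      then show ?thesis using g b by (intro exI[of _ "g(a := b)"]) auto
    qed auto
  qed
qed

text \<open>Complementation turns adding an element into deleting one, so Hall's condition becomes
  the shadow inequality for sets of size \<open>CARD('a) - d\<close>. The size bound passes to
  subfamilies.\<close>

lemma upper_matching:
  fixes \<F> :: "'a::finite set set"
  assumes card_F: "\<forall>F\<in>\<F>. card F = d"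
    and card_\<F>: "card \<F> \<le> (\<Sum>j = 1..CARD('a) - d. (2 * j - 1) choose j)"
  obtains \<phi> where "inj_on \<phi> \<F>" "\<forall>F\<in>\<F>. F \<subseteq> \<phi> F \<and> card (\<phi> F) = Suc d"
proof -
  define N where "N F = (\<lambda>y. insert y F) ` (- F)" for F :: "'a set"
  have "\<exists>\<phi>. inj_on \<phi> \<F> \<and> (\<forall>F\<in>\<F>. \<phi> F \<in> N F)"
  proof (rule Hall)
    fix J assume J: "J \<subseteq> \<F>"
    have inj: "inj_on uminus X" for X :: "'a set set" by (auto simp: inj_on_def)
    have card_J: "card (uminus ` J) = card J" using inj by (rule card_image)
    have "\<forall>F\<in>uminus ` J. card F = CARD('a) - d"
      using J card_F by (auto simp: Compl_eq_Diff_UNIV card_Diff_subset)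
    moreover have "card (uminus ` J) \<le> (\<Sum>j = 1..CARD('a) - d. (2 * j - 1) choose j)"
      using card_J card_mono[of \<F> J] J card_\<F> by simp
    ultimately have "card (uminus ` J) \<le> card (shadow (uminus ` J))"
      by (intro card_le_card_shadow[of UNIV]) auto
    also have "shadow (uminus ` J) \<subseteq> uminus ` (\<Union>F\<in>J. N F)"
    proof
      fix E assume "E \<in> shadow (uminus ` J)"
      then obtain x F where x: "x \<notin> E" "insert x E = - F" "F \<in> J" by (auto simp: shadow_def)
      then have "x \<notin> F" "E = - insert x F" by auto
      then show "E \<in> uminus ` (\<Union>F\<in>J. N F)" using x(3) by (auto simp: N_def)
    qed
    then have "card (shadow (uminus ` J)) \<le> card (uminus ` (\<Union>F\<in>J. N F))"
      by (intro card_mono) auto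
    also have "\<dots> = card (\<Union>F\<in>J. N F)" using inj by (rule card_image)
    finally show "card J \<le> card (\<Union>F\<in>J. N F)" using card_J by simp
  qed auto
  then obtain \<phi> where \<phi>: "inj_on \<phi> \<F>" "\<forall>F\<in>\<F>. \<phi> F \<in> N F" by blast
  have "\<forall>F\<in>\<F>. F \<subseteq> \<phi> F \<and> card (\<phi> F) = Suc d"
    using \<phi>(2) card_F by (fastforce simp: N_def)
  with \<phi>(1) show thesis by (rule that)
qed

subsection \<open>Squarefree monomial ideals\<close>

abbreviation supp :: "('a \<Rightarrow>\<^sub>0 'b::zero) \<Rightarrow> 'a set" where
  "supp \<equiv> Poly_Mapping.keys"

abbreviation coef :: "('a \<Rightarrow>\<^sub>0 'b::zero) \<Rightarrow> 'a \<Rightarrow> 'b" where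
  "coef \<equiv> Poly_Mapping.lookup"

text \<open>With \<open>S = UNIV\<close> this expands \<open>p\<close> into its terms; with
  \<open>S\<close> a cell of an interval partition it extracts a component of a Stanley
  decomposition.\<close>

lemma coef_restriction:
  "coef (\<Sum>m\<in>supp p \<inter> S. Poly_Mapping.single m (coef p m)) k = (if k \<in> S then coef p k else 0)"
  by (auto simp: lookup_sum lookup_single when_def in_keys_iff)

lemma sum_single_coef: "(\<Sum>m\<in>supp p. Poly_Mapping.single m (coef p m)) = p"
  using coef_restriction[of p UNIV] by (intro poly_mapping_eqI) simp

lemma mult_monomial:
  "p * monomial a = (\<Sum>m\<in>supp p. Poly_Mapping.single (m + a) (coef p m))"
proof -
  have "p * monomial a = (\<Sum>m\<in>supp p. Poly_Mapping.single m (coef p m)) * monomial a"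
    by (simp add: sum_single_coef)
  then show ?thesis by (simp add: sum_distrib_right monomial_def mult_single)
qed

lemma coef_mult_monomial: "coef (p * monomial a) (m + a) = coef p m"
  by (auto simp: mult_monomial lookup_sum lookup_single when_def in_keys_iff)

lemma mult_monomial_eq_0: "p * monomial a = 0 \<Longrightarrow> p = 0"
  by (metis coef_mult_monomial lookup_zero poly_mapping_eqI)

lemma supp_mult_monomial: "m \<in> supp (p * monomial a) \<Longrightarrow> \<exists>m'\<in>supp p. m = m' + a"
  using keys_mult[of p "monomial a"] by (auto simp: monomial_def split: if_splits)

lemma supp_add: "supp (a + b) = supp a \<union> supp b" for a b :: "'a expo"
  by (auto simp: in_keys_iff lookup_add)

text \<open>Entries of \<open>a\<close> are 0 or 1, so truncated subtraction is exact once the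
  supports are nested: divisibility by a squarefree monomial is a condition on supports.\<close>

lemma squarefree_expo_le:
  assumes "squarefree_expo a" "supp a \<subseteq> supp m"
  shows "m = (m - a) + a"
proof (rule poly_mapping_eqI)
  fix i
  have "coef a i \<le> 1" using assms by (simp add: squarefree_expo_def)
  moreover have "coef a i \<noteq> 0 \<Longrightarrow> coef m i \<noteq> 0" using assms(2) in_keys_iff by (metis subsetD)
  ultimately show "coef m i = coef (m - a + a) i"
    by (cases "coef a i = 0") (simp_all add: lookup_add lookup_minus)
qed

lemma squarefree_expo_eqI:
  "squarefree_expo a \<Longrightarrow> squarefree_expo b \<Longrightarrow> supp a = supp b \<Longrightarrow> a = b"
  by (rule poly_mapping_eqI)
    (metis squarefree_expo_def in_keys_iff le_antisym less_one linorder_not_le not_less_eq_eq One_nat_def)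

lemma finite_squarefree_expo: "finite {a :: 'n::finite expo. squarefree_expo a}"
proof (rule inj_on_finite[of supp _ UNIV])
  show "inj_on supp {a :: 'n expo. squarefree_expo a}"
    by (auto intro: inj_onI squarefree_expo_eqI)
qed auto

lemma card_supp_le_total_degree: "card (supp a) \<le> total_degree a"
proof -
  have "card (supp a) = (\<Sum>i\<in>supp a. 1)" by simp
  also have "\<dots> \<le> (\<Sum>i\<in>supp a. coef a i)"
    by (intro sum_mono) (simp add: in_keys_iff Suc_leI)
  also have "\<dots> \<le> total_degree a" unfolding total_degree_def by (intro sum_mono2) auto
  finally show ?thesis .
qed

lemma total_degree_squarefree: "squarefree_expo a \<Longrightarrow> total_degree a = card (supp a)"
proof -
  assume a: "squarefree_expo a"
  have "total_degree a = (\<Sum>i\<in>supp a. coef a i)"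
    unfolding total_degree_def by (intro sum.mono_neutral_right) (auto simp: in_keys_iff)
  also have "\<dots> = (\<Sum>i\<in>supp a. 1)"
  proof (intro sum.cong)
    fix i assume "i \<in> supp a"
    then have "coef a i \<noteq> 0" by (simp add: in_keys_iff)
    moreover have "coef a i \<le> 1" using a by (simp add: squarefree_expo_def)
    ultimately show "coef a i = 1" by simp
  qed simp
  finally show ?thesis by simp
qed

lemma total_degree_add: "total_degree (a + b) = total_degree a + total_degree b"
  by (simp add: total_degree_def lookup_add sum.distrib)

lemma total_degree_eq_0: "total_degree a = 0 \<Longrightarrow> a = 0"
  by (intro poly_mapping_eqI) (simp add: total_degree_def)

definition indicator_expo :: "'n::finite set \<Rightarrow> 'n expo" where
  "indicator_expo F = Abs_poly_mapping (\<lambda>i. if i \<in> F then 1 else 0)"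

lemma coef_indicator_expo: "coef (indicator_expo F) i = (if i \<in> F then 1 else 0)"
  by (simp add: indicator_expo_def)

lemma supp_indicator_expo [simp]: "supp (indicator_expo F) = F"
  by (auto simp: in_keys_iff coef_indicator_expo split: if_splits)

lemma squarefree_indicator_expo [simp]: "squarefree_expo (indicator_expo F)"
  by (simp add: squarefree_expo_def coef_indicator_expo)

lemma total_degree_indicator_expo [simp]: "total_degree (indicator_expo F) = card F"
  by (simp add: total_degree_squarefree)

text \<open>Multiplication by the monomial of \<open>C\<close> translates exponents, and a monomial
  is divisible by it exactly when its support contains \<open>C\<close>.\<close>

lemma stanley_space_indicator_expo:
  assumes "C \<subseteq> D"
  shows "(\<lambda>p. p * monomial (indicator_expo C)) ` subring_vars D =
    {q :: ('n::finite, 'k::field) mpoly. \<forall>m\<in>supp q. C \<subseteq> supp m \<and> supp m \<subseteq> D}"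
proof (intro equalityI subsetI)
  fix q :: "('n, 'k) mpoly"
  assume "q \<in> (\<lambda>p. p * monomial (indicator_expo C)) ` subring_vars D"
  then obtain p where "p \<in> subring_vars D" "q = p * monomial (indicator_expo C)" by auto
  then show "q \<in> {q. \<forall>m\<in>supp q. C \<subseteq> supp m \<and> supp m \<subseteq> D}"
    using assms supp_mult_monomial[of _ p "indicator_expo C"]
    by (fastforce simp: subring_vars_def supp_add)
next
  fix q :: "('n, 'k) mpoly"
  assume "q \<in> {q. \<forall>m\<in>supp q. C \<subseteq> supp m \<and> supp m \<subseteq> D}"
  then have q: "C \<subseteq> supp m" "supp m \<subseteq> D" if "m \<in> supp q" for m using that by auto
  \<comment> \<open>The termwise quotient of \<open>q\<close> by the monomial of
    \<open>C\<close>.\<close>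
  let ?p = "\<Sum>m\<in>supp q. Poly_Mapping.single (m - indicator_expo C) (coef q m)"
  have "?p * monomial (indicator_expo C)
      = (\<Sum>m\<in>supp q. Poly_Mapping.single (m - indicator_expo C + indicator_expo C) (coef q m))"
    by (simp add: sum_distrib_right monomial_def mult_single)
  also have "\<dots> = (\<Sum>m\<in>supp q. Poly_Mapping.single m (coef q m))"
  proof (intro sum.cong refl)
    fix m assume "m \<in> supp q"
    then have "m = m - indicator_expo C + indicator_expo C"
      using q by (intro squarefree_expo_le) auto
    then show "Poly_Mapping.single (m - indicator_expo C + indicator_expo C) (coef q m) =
        Poly_Mapping.single m (coef q m)" by simp
  qed
  finally have "q = ?p * monomial (indicator_expo C)" by (simp add: sum_single_coef)
  moreover have "?p \<in> subring_vars D"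
    unfolding subring_vars_def
  proof (intro CollectI ballI)
    fix k assume "k \<in> supp ?p"
    then obtain m where m: "m \<in> supp q" "k = m - indicator_expo C"
      using keys_sum[of "\<lambda>m. Poly_Mapping.single (m - indicator_expo C) (coef q m)" "supp q"]
      by (auto split: if_splits)
    have "supp k \<subseteq> supp m" unfolding m(2) by (auto simp: in_keys_iff lookup_minus)
    then show "supp k \<subseteq> D" using q m by blast
  qed
  ultimately show "q \<in> (\<lambda>p. p * monomial (indicator_expo C)) ` subring_vars D" by blast
qed

text \<open>Membership in a monomial ideal is decided term by term, and for squarefree generators by
  supports alone. This reduces the ideal to an up-set of sets of variables.\<close>

lemma in_squarefree_ideal_iff:
  fixes p :: "('n, 'k::field) mpoly"
  assumes "\<forall>a\<in>A. squarefree_expo a"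
  shows "p \<in> ideal.span (monomial ` A) \<longleftrightarrow> (\<forall>m\<in>supp p. \<exists>a\<in>A. supp a \<subseteq> supp m)"
proof
  assume p: "p \<in> ideal.span (monomial ` A)"
  show "\<forall>m\<in>supp p. \<exists>a\<in>A. supp a \<subseteq> supp m"
  proof
    fix m assume "m \<in> supp p"
    then obtain a c where "a \<in> A" "m = c + a" using keys_in_monomial_ideal[OF p] by blast
    then show "\<exists>a\<in>A. supp a \<subseteq> supp m" by (auto simp: supp_add)
  qed
next
  assume R: "\<forall>m\<in>supp p. \<exists>a\<in>A. supp a \<subseteq> supp m"
  have "(\<Sum>m\<in>supp p. Poly_Mapping.single m (coef p m)) \<in> ideal.span (monomial ` A)"
  proof (rule ideal.span_sum)
    fix m assume "m \<in> supp p"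
    then obtain a where a: "a \<in> A" "supp a \<subseteq> supp m" using R by blast
    have "m = (m - a) + a" using a assms by (intro squarefree_expo_le) auto
    then have "Poly_Mapping.single m (coef p m) = Poly_Mapping.single ((m - a) + a) (coef p m)"
      by (rule arg_cong[where f = "\<lambda>k. Poly_Mapping.single k (coef p m)"])
    also have "\<dots> \<in> ideal.span (monomial ` A)" using a(1) by (rule single_in_monomial_ideal)
    finally show "Poly_Mapping.single m (coef p m) \<in> ideal.span (monomial ` A)" .
  qed
  then show "p \<in> ideal.span (monomial ` A)" by (simp add: sum_single_coef)
qed

text \<open>Some element of \<open>G\<close> divides the monomial of \<open>F\<close>. It lies in
  \<open>I\<close>, so its degree is at least \<open>d\<close>, and the cofactor must have degree
  0.\<close>

lemma indicator_expo_is_minimal_generator: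
  fixes I :: "('n::finite, 'k::field) mpoly set"
  assumes I: "I = ideal.span (monomial ` A)"
    and A: "\<forall>a\<in>A. d \<le> card (supp a)"
    and F: "card F = d" "monomial (indicator_expo F) \<in> I"
    and G: "is_minimal_monomial_generators I G"
  shows "monomial (indicator_expo F) \<in> G"
proof -
  obtain E where E: "G = monomial ` E"
    using G unfolding is_minimal_monomial_generators_def by (meson subset_imageE)
  then have "(monomial (indicator_expo F) :: ('n, 'k) mpoly) \<in> ideal.span (monomial ` E)"
    using G F(2) by (simp add: is_minimal_monomial_generators_def)
  then obtain e c where e: "e \<in> E" "indicator_expo F = c + e"
    by (auto simp: monomial_in_monomial_ideal_iff)
  then have "(monomial e :: ('n, 'k) mpoly) \<in> ideal.span (monomial ` A)"
    using G E I unfolding is_minimal_monomial_generators_def by (metis ideal.span_base imageI)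
  then obtain a where "a \<in> A" "supp a \<subseteq> supp e"
    by (auto simp: monomial_in_monomial_ideal_iff supp_add)
  then have "d \<le> total_degree e"
    using A card_mono[of "supp e" "supp a"] card_supp_le_total_degree[of e] by fastforce
  moreover have "total_degree c + total_degree e = d"
    using F(1) total_degree_add[of c e] by (simp flip: e(2))
  ultimately have "c = 0" by (intro total_degree_eq_0) simp
  then show ?thesis using e E by simp
qed

lemma card_le_mu:
  fixes I :: "('n::finite, 'k::field) mpoly set"
  assumes I: "I = ideal.span (monomial ` A)"
    and sqf: "\<forall>a\<in>A. squarefree_expo a"
    and deg: "\<forall>a\<in>A. d \<le> total_degree a"
  shows "card {F. (\<exists>a\<in>A. supp a \<subseteq> F) \<and> card F = d} \<le> mu d I"
proof -
  let ?mon = "monomial :: 'n expo \<Rightarrow> ('n, 'k) mpoly"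
  let ?P = "{F. (\<exists>a\<in>A. supp a \<subseteq> F) \<and> card F = d}"
  let ?M = "{g \<in> minimal_monomial_generators I. \<exists>a. g = ?mon a \<and> total_degree a = d}"
  have G: "is_minimal_monomial_generators I (minimal_monomial_generators I)"
    unfolding minimal_monomial_generators_def I
    by (rule theI', rule ex1_minimal_monomial_generators) auto
  \<comment> \<open>An infinite set has \<open>card\<close> 0, so the injection needs
    \<open>?M\<close> finite. An element of \<open>?M\<close> is a multiple of a generator from
    \<open>A\<close> of degree at least \<open>d\<close>, hence equal to it.\<close>
  have "?M \<subseteq> ?mon ` A"
  proof
    fix g assume "g \<in> ?M"
    then obtain a where a: "g = ?mon a" "total_degree a = d" "g \<in> minimal_monomial_generators I"
      by blast
    then have "?mon a \<in> ideal.span (monomial ` A)"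
      using G I unfolding is_minimal_monomial_generators_def by (metis ideal.span_base)
    then obtain b c where b: "b \<in> A" "a = c + b"
      by (auto simp: monomial_in_monomial_ideal_iff)
    then have "total_degree c = 0" using a(2) deg by (auto simp: total_degree_add)
    then show "g \<in> ?mon ` A" using a(1) b total_degree_eq_0[of c] by simp
  qed
  moreover have "finite A" using sqf by (intro finite_subset[OF _ finite_squarefree_expo]) auto
  ultimately have fin: "finite ?M" by (meson finite_imageI finite_subset)
  have "inj_on (?mon \<circ> indicator_expo) ?P"
  proof (rule inj_onI)
    fix F F' assume "(?mon \<circ> indicator_expo) F = (?mon \<circ> indicator_expo) F'"
    then have "supp (?mon (indicator_expo F)) = supp (?mon (indicator_expo F'))" by simp
    then have "supp (indicator_expo F) = supp (indicator_expo F')" by (simp add: monomial_def)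
    then show "F = F'" by simp
  qed
  moreover have "(?mon \<circ> indicator_expo) ` ?P \<subseteq> ?M"
  proof safe
    fix F a assume F: "d = card F" "a \<in> A" "supp a \<subseteq> F"
    have "?mon (indicator_expo F) \<in> I"
      unfolding I in_squarefree_ideal_iff[OF sqf] using F by (auto simp: monomial_def)
    then show "(?mon \<circ> indicator_expo) F \<in> minimal_monomial_generators I"
      using indicator_expo_is_minimal_generator[OF I _ _ _ G] sqf deg F(1)
      by (simp add: total_degree_squarefree)
    show "\<exists>a. (?mon \<circ> indicator_expo) F = ?mon a \<and> total_degree a = card F"
      by (intro exI[of _ "indicator_expo F"]) simp
  qed
  ultimately show ?thesis unfolding mu_def using fin by (rule card_inj_on_le)
qed

subsection \<open>Interval partitions and Stanley depth\<close>

text \<open>Sorting exponents by the interval containing their support splits the terms of each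
  element of \<open>I\<close> into disjoint cells, and each interval's Stanley space consists of the
  polynomials supported in its cell.\<close>

lemma sdepth_ideal_ge_interval_partition:
  fixes I :: "('n::finite, 'k::field) mpoly set"
  assumes I: "I = ideal.span (monomial ` A)"
    and sqf: "\<forall>a\<in>A. squarefree_expo a"
    and nz: "I \<noteq> {0}"
    and Q: "\<And>C D. (C, D) \<in> Q \<Longrightarrow> (\<exists>a\<in>A. supp a \<subseteq> C) \<and> C \<subseteq> D \<and> r \<le> card D"
    and part: "\<And>F. \<exists>a\<in>A. supp a \<subseteq> F \<Longrightarrow> \<exists>!q. q \<in> Q \<and> fst q \<subseteq> F \<and> F \<subseteq> snd q"
  shows "r \<le> sdepth_ideal I"
proof -
  let ?mon = "monomial :: 'n expo \<Rightarrow> ('n, 'k) mpoly"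
  have "finite A" using sqf by (intro finite_subset[OF _ finite_squarefree_expo]) auto
  then have "multigraded_module (*) (ideal.span (?mon ` A)) (\<lambda>a. ideal.span (?mon ` A) \<inter> poly_comp a)"
    using nz I by (intro multigraded_module_ideal) auto
  then interpret mm: multigraded_module "(*)" I "\<lambda>a. I \<inter> poly_comp a"
    unfolding I .
  \<comment> \<open>Distinctness ensures that different positions of the list have disjoint
    cells.\<close>
  obtain qs where qs: "set qs = Q" "distinct qs" using finite_distinct_list[of Q] by auto
  define ps where "ps = map (\<lambda>(C, D). (?mon (indicator_expo C), D)) qs"
  define T where "T i = {m :: 'n expo. fst (qs ! i) \<subseteq> supp m \<and> supp m \<subseteq> snd (qs ! i)}" for i
  have len: "length ps = length qs" by (simp add: ps_def)
  have nthQ: "qs ! i \<in> Q" if "i < length qs" for i using that qs(1) by auto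
  have space: "mm.stanley_space (fst (ps ! i)) (snd (ps ! i)) = {q. supp q \<subseteq> T i}"
    if i: "i < length qs" for i
  proof -
    obtain C D where CD: "qs ! i = (C, D)" by fastforce
    then have "C \<subseteq> D" using Q nthQ[OF i] by metis
    moreover have "fst (ps ! i) = ?mon (indicator_expo C)" "snd (ps ! i) = D"
      using i CD by (simp_all add: ps_def)
    moreover have "{q :: ('n, 'k) mpoly. supp q \<subseteq> T i} =
        {q. \<forall>m\<in>supp q. C \<subseteq> supp m \<and> supp m \<subseteq> D}"
      using CD by (auto simp: T_def)
    ultimately show ?thesis
      by (simp add: mm.stanley_space_def stanley_space_indicator_expo)
  qed
  have disj: "i = j" if "m \<in> T i" "m \<in> T j" "i < length qs" "j < length qs" for i j m
  proof -
    have "\<exists>a\<in>A. supp a \<subseteq> supp m"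
      using Q[of "fst (qs ! i)" "snd (qs ! i)"] nthQ[OF that(3)] that(1)
      by (simp add: T_def) (meson subset_trans)
    then obtain q where q: "\<And>q'. q' \<in> Q \<and> fst q' \<subseteq> supp m \<and> supp m \<subseteq> snd q' \<Longrightarrow> q' = q"
      by (rule ex1E[OF part]) blast
    have "qs ! i = q" "qs ! j = q"
      using that nthQ by (intro q; simp add: T_def)+
    then have "qs ! i = qs ! j" by simp
    then show ?thesis using qs(2) that by (simp add: nth_eq_iff_index_eq)
  qed
  have cover: "\<exists>i<length qs. m \<in> T i" if "x \<in> I" "m \<in> supp x" for x m
  proof -
    have "\<exists>a\<in>A. supp a \<subseteq> supp m" using that in_squarefree_ideal_iff[OF sqf] I by blast
    from ex1_implies_ex[OF part[OF this]]
    obtain q where "q \<in> Q" "fst q \<subseteq> supp m" "supp m \<subseteq> snd q" by (elim exE conjE)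
    then show ?thesis using qs(1) by (auto simp: in_set_conv_nth T_def)
  qed
  \<comment> \<open>Cells are disjoint, so a coefficient of the sum determines that of the one
    summand responsible for it; existence and uniqueness of the components both rest on
    this.\<close>
  have coef_sum_list: "coef (sum_list vs) m = coef (vs ! i) m"
    if "length vs = length qs" "\<forall>j<length qs. supp (vs ! j) \<subseteq> T j" "i < length qs" "m \<in> T i"
    for vs :: "('n, 'k) mpoly list" and i m
  proof -
    have zero: "coef (vs ! j) m = 0" if "j < length qs" "j \<noteq> i" for j
      using disj[of m i j] that \<open>\<forall>j<length qs. supp (vs ! j) \<subseteq> T j\<close> \<open>i < length qs\<close> \<open>m \<in> T i\<close>
      by (metis in_keys_iff subsetD)
    have "coef (sum_list vs) m = (\<Sum>j = 0..<length qs. coef (vs ! j) m)"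
      using that(1) by (simp add: sum_list_sum_nth lookup_sum)
    also have "\<dots> = (\<Sum>j\<in>{i}. coef (vs ! j) m)"
      using that(3) zero by (intro sum.mono_neutral_right) auto
    finally show ?thesis by simp
  qed
  have unique: "\<exists>!vs. length vs = length ps \<and>
      (\<forall>i<length ps. vs ! i \<in> mm.stanley_space (fst (ps ! i)) (snd (ps ! i))) \<and> sum_list vs = x"
    if x: "x \<in> I" for x
  proof (rule ex1I)
    let ?vs = "map (\<lambda>i. \<Sum>m\<in>supp x \<inter> T i. Poly_Mapping.single m (coef x m)) [0..<length qs]"
    have vs: "length ?vs = length qs" "\<forall>j<length qs. supp (?vs ! j) \<subseteq> T j"
      using coef_restriction[of x "T _"] by (auto simp: in_keys_iff split: if_splits)
    have "sum_list ?vs = x"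
    proof (rule poly_mapping_eqI)
      fix m
      show "coef (sum_list ?vs) m = coef x m"
      proof (cases "\<exists>i<length qs. m \<in> T i")
        case True
        then obtain i where i: "i < length qs" "m \<in> T i" by blast
        then show ?thesis using coef_sum_list[OF vs i] by (simp add: coef_restriction)
      next
        case False
        then have "coef x m = 0" using cover[OF x, of m] by (auto simp: in_keys_iff)
        moreover have "coef (sum_list ?vs) m = (\<Sum>j = 0..<length ?vs. coef (?vs ! j) m)"
          by (simp only: sum_list_sum_nth lookup_sum)
        moreover have "\<dots> = 0"
          using False by (intro sum.neutral) (simp add: coef_restriction)
        ultimately show ?thesis by simp
      qed
    qed
    then show "length ?vs = length ps \<and>
      (\<forall>i<length ps. ?vs ! i \<in> mm.stanley_space (fst (ps ! i)) (snd (ps ! i))) \<and> sum_list ?vs = x"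
      using vs space len by auto
    fix ws assume "length ws = length ps \<and>
      (\<forall>i<length ps. ws ! i \<in> mm.stanley_space (fst (ps ! i)) (snd (ps ! i))) \<and> sum_list ws = x"
    then have ws: "length ws = length qs" "\<forall>j<length qs. supp (ws ! j) \<subseteq> T j" "sum_list ws = x"
      using space len by auto
    show "ws = ?vs"
    proof (rule nth_equalityI)
      fix i assume "i < length ws"
      then have i: "i < length qs" using ws by simp
      show "ws ! i = ?vs ! i"
      proof (rule poly_mapping_eqI)
        fix m
        show "coef (ws ! i) m = coef (?vs ! i) m"
        proof (cases "m \<in> T i")
          case True
          then show ?thesis using coef_sum_list[OF ws(1,2) i True] ws(3) i by (simp add: coef_restriction)
        next
          case False
          then have "coef (ws ! i) m = 0" using ws(2) i in_keys_iff by (metis subsetD)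
          then show ?thesis using False i by (simp add: coef_restriction)
        qed
      qed
    qed (use ws in simp)
  qed
  have dec: "mm.stanley_decomposition ps"
    unfolding mm.stanley_decomposition_def
  proof (intro conjI ballI, goal_cases)
    case (1 q)
    then obtain C D where CD: "(C, D) \<in> Q" "q = (?mon (indicator_expo C), D)"
      using qs by (auto simp: ps_def)
    have "?mon (indicator_expo C) \<in> I"
      unfolding I in_squarefree_ideal_iff[OF sqf] using Q[OF CD(1)] by (auto simp: monomial_def)
    moreover have "?mon (indicator_expo C) \<in> poly_comp (\<lambda>i. int (coef (indicator_expo C) i))"
      by (simp add: poly_comp_def monomial_def)
    ultimately show ?case using CD(2) mult_monomial_eq_0 by auto
  qed (use unique in blast)
  \<comment> \<open>\<open>Min\<close> says nothing useful about the empty set; an empty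
    decomposition would force \<open>I\<close> to be zero.\<close>
  have nonempty: "P \<noteq> []" if "mm.stanley_decomposition P" for P
  proof
    assume "P = []"
    then have "x = 0" if "x \<in> I" for x
      using \<open>mm.stanley_decomposition P\<close> that unfolding mm.stanley_decomposition_def by auto
    then show False using nz ideal.span_zero[of "?mon ` A"] unfolding I by blast
  qed
  have "r \<le> mm.sdepth_decomposition ps"
    unfolding mm.sdepth_decomposition_def
  proof (rule Min.boundedI)
    show "(\<lambda>(u, Z). card Z) ` set ps \<noteq> {}" using nonempty[OF dec] by simp
    fix c assume "c \<in> (\<lambda>(u, Z). card Z) ` set ps"
    then obtain C D where "(C, D) \<in> Q" "c = card D" using qs(1) by (auto simp: ps_def)
    then show "r \<le> c" using Q by blast
  qed simp
  also have "mm.sdepth_decomposition ps \<le> mm.sdepth"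
    unfolding mm.sdepth_def
  proof (rule Max_ge)
    \<comment> \<open>\<open>Max\<close> is meaningful only for a finite set of depths, and no depth
      exceeds the number of variables.\<close>
    have bound: "mm.sdepth_decomposition P \<le> CARD('n)" if "mm.stanley_decomposition P" for P
    proof -
      have "hd P \<in> set P" using nonempty[OF that] by simp
      then have "mm.sdepth_decomposition P \<le> card (snd (hd P))"
        unfolding mm.sdepth_decomposition_def by (intro Min_le) (auto simp: case_prod_beta)
      also have "\<dots> \<le> CARD('n)" by (intro card_mono) auto
      finally show ?thesis .
    qed
    show "finite {mm.sdepth_decomposition P | P. mm.stanley_decomposition P}"
    proof (rule finite_subset)
      show "{mm.sdepth_decomposition P | P. mm.stanley_decomposition P} \<subseteq> {..CARD('n)}"
      proof
        fix c assume "c \<in> {mm.sdepth_decomposition P | P. mm.stanley_decomposition P}"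
        then obtain P where "c = mm.sdepth_decomposition P" "mm.stanley_decomposition P"
          by (elim CollectE exE conjE)
        then show "c \<in> {..CARD('n)}" using bound[of P] by simp
      qed
    qed simp
  next
    show "mm.sdepth_decomposition ps \<in> {mm.sdepth_decomposition P | P. mm.stanley_decomposition P}"
      by (intro CollectI exI[of _ ps] conjI refl dec)
  qed
  finally show ?thesis unfolding sdepth_ideal_def .
qed

theorem theorem1p1:
  fixes I :: "('n::finite, 'k::field) mpoly set"
    and A :: "'n expo set"
    and d :: nat
  assumes generated: "I = ideal.span (monomial ` A)"
    and squarefree: "\<forall>a\<in>A. squarefree_expo a"
    and degree: "\<forall>a\<in>A. d \<le> total_degree a"
    and nonzero: "I \<noteq> {0}"
    and mu_bound: "mu d I \<le> min (CARD('n) choose (d + 1))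
                               (\<Sum>j = 1..CARD('n) - d. (2 * j - 1) choose j)"
  shows "sdepth_ideal I \<ge> d + 1"
proof -
  define P where "P = {F. \<exists>a\<in>A. supp a \<subseteq> F}"
  define \<F> where "\<F> = {F\<in>P. card F = d}"
  have "card \<F> \<le> (\<Sum>j = 1..CARD('n) - d. (2 * j - 1) choose j)"
    using card_le_mu[OF generated squarefree degree] mu_bound by (simp add: \<F>_def P_def)
  then obtain \<phi> where inj: "inj_on \<phi> \<F>" and \<phi>: "\<forall>F\<in>\<F>. F \<subseteq> \<phi> F \<and> card (\<phi> F) = Suc d"
    using upper_matching[of \<F> d] by (auto simp: \<F>_def)
  have card_P: "d \<le> card F" if F: "F \<in> P" for F
  proof -
    obtain a where a: "a \<in> A" "supp a \<subseteq> F" using F by (auto simp: P_def)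
    then have "d \<le> card (supp a)" using squarefree degree by (simp flip: total_degree_squarefree)
    also have "\<dots> \<le> card F" using a(2) by (intro card_mono) auto
    finally show ?thesis .
  qed
  \<comment> \<open>The sizes of the endpoints differ by one, so the interval contains nothing
    else.\<close>
  have two_point: "F = G \<or> F = \<phi> G" if "G \<in> \<F>" "G \<subseteq> F" "F \<subseteq> \<phi> G" for F G
  proof (cases "card F = d")
    case True
    then show ?thesis using that card_subset_eq[of F G] by (simp add: \<F>_def)
  next
    case False
    have "card G \<le> card F" "card F \<le> card (\<phi> G)" using that by (auto intro: card_mono)
    moreover have "card G = d" "card (\<phi> G) = Suc d" using that(1) \<phi> by (auto simp: \<F>_def)
    ultimately have "card F = card (\<phi> G)" using False by simp
    then show ?thesis using that card_subset_eq[of "\<phi> G" F] by simp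
  qed
  have not_low: "\<phi> G \<notin> \<F>" if "G \<in> \<F>" for G using that \<phi> by (auto simp: \<F>_def)
  \<comment> \<open>Upper endpoints are left out of the singletons, since they are already
    covered.\<close>
  define Q where "Q = (\<lambda>F. (F, \<phi> F)) ` \<F> \<union> (\<lambda>F. (F, F)) ` (P - \<F> - \<phi> ` \<F>)"
  show ?thesis
  proof (rule sdepth_ideal_ge_interval_partition[OF generated squarefree nonzero])
    fix C D assume "(C, D) \<in> Q"
    then consider "C \<in> \<F>" "D = \<phi> C" | "C \<in> P" "C \<notin> \<F>" "D = C" by (auto simp: Q_def)
    then show "(\<exists>a\<in>A. supp a \<subseteq> C) \<and> C \<subseteq> D \<and> d + 1 \<le> card D"
    proof cases
      case 1
      then have "C \<in> P" by (simp add: \<F>_def)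
      then show ?thesis using 1 \<phi> by (simp add: P_def)
    next
      case 2
      \<comment> \<open>Members of \<open>P\<close> have at least \<open>d\<close> elements, so
        those outside \<open>\<F>\<close> have at least \<open>d + 1\<close>.\<close>
      then have "card C \<noteq> d" by (simp add: \<F>_def)
      then show ?thesis using 2 card_P[of C] by (simp add: P_def)
    qed
  next
    fix F assume "\<exists>a\<in>A. supp a \<subseteq> F"
    then have "F \<in> P" by (simp add: P_def)
    then consider "F \<in> \<F>" | G where "G \<in> \<F>" "F = \<phi> G" | "F \<in> P - \<F> - \<phi> ` \<F>" by blast
    then show "\<exists>!q. q \<in> Q \<and> fst q \<subseteq> F \<and> F \<subseteq> snd q"
    proof cases
      case 1
      show ?thesis
      proof (rule ex1I[of _ "(F, \<phi> F)"])
        show "(F, \<phi> F) \<in> Q \<and> fst (F, \<phi> F) \<subseteq> F \<and> F \<subseteq> snd (F, \<phi> F)"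
          using 1 \<phi> by (simp add: Q_def)
        fix q assume q: "q \<in> Q \<and> fst q \<subseteq> F \<and> F \<subseteq> snd q"
        then show "q = (F, \<phi> F)"
          using 1 two_point[of "fst q" F] not_low by (auto simp: Q_def)
      qed
    next
      case 2
      show ?thesis
      proof (rule ex1I[of _ "(G, \<phi> G)"])
        show "(G, \<phi> G) \<in> Q \<and> fst (G, \<phi> G) \<subseteq> F \<and> F \<subseteq> snd (G, \<phi> G)"
          using 2 \<phi> by (simp add: Q_def)
        \<comment> \<open>By size \<open>F\<close> is not a lower endpoint, and injectivity of
          \<open>\<phi>\<close> makes it the upper endpoint of only one interval.\<close>
        fix q assume q: "q \<in> Q \<and> fst q \<subseteq> F \<and> F \<subseteq> snd q"
        then show "q = (G, \<phi> G)"
          using 2 two_point[of "fst q" F] not_low inj_onD[OF inj, of G "fst q"] by (auto simp: Q_def)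
      qed
    next
      case 3
      show ?thesis
      proof (rule ex1I[of _ "(F, F)"])
        show "(F, F) \<in> Q \<and> fst (F, F) \<subseteq> F \<and> F \<subseteq> snd (F, F)"
          using 3 by (simp add: Q_def)
        fix q assume q: "q \<in> Q \<and> fst q \<subseteq> F \<and> F \<subseteq> snd q"
        then show "q = (F, F)"
          using 3 two_point[of "fst q" F] by (auto simp: Q_def)
      qed
    qed
  qed
qed

end
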